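(* Let $n\ge2$, let $\lambda\in\mathbb C$ be non-zero, and let $c=(c_1,\dots,c_n)\in\mathbb R^n$. Define the linear functional $\Psi_c$ on $\mathcal S(M_n(\mathbb R)[t^{-1}]t^{-1})_\lambda$ by $$\Psi_c(f)=\int f\left(X_{-1},X_{-2},0,0,\dots\right)\,e^{2\pi i\left(c_1\frac{x_{-1}^{1,1}}{x_{-1}^{2,1}}+\cdots+c_{n-1}\frac{x_{-1}^{n-1,n-1}}{x_{-1}^{n,n-1}}+c_n\frac{x_{-1}^{n,n}}{x_{-2}^{1,n}}\right)}\,dx,$$ where $X_{-1}$ is the upper Hessenberg matrix with $(p,q)$-entry $x_{-1}^{p,q}$ for $p\le q+1$ and $0$ for $p>q+1$, $X_{-2}$ is the matrix whose only non-zero entry is the $(1,n)$-entry $x_{-2}^{1,n}$, and the integral is with respect to Lebesgue measure over all the real variables $x_{-1}^{p,q}$ ($p\le q+1$) and $x_{-2}^{1,n}$. Then $\Psi_c$ is a Whittaker functional for the first copy of $\widehat{SL_n}(F)$: for every $u\in SL_n(\mathbb R[[t]])$ with $u(0)$ upper triangular unipotent and every $f\in\mathcal S(M_n(\mathbb R)[t^{-1}]t^{-1})_\lambda$, $$(\pi_1^*(u)\Psi_c)(f)=\hat\chi_c(u)\,\Psi_c(f),\qquad \hat\chi_c(u)=e^{-2\pi i(c_1u_1+\cdots+c_{n-1}u_{n-1}+c_nv_n)},$$ where $u_1,\dots,u_{n-1}$ are the superdiagonal entries of $u(0)$ ($u_k$ being the $(k,k+1)$-entry) and $v_n$ is the $(n,1)$-entry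 of $u'(0)$, the coefficient of $t$ in $u$.
   Context: $F=\mathbb R((t))$, $M_n(\mathbb R)$ is the space of real $n\times n$ matrices. An element of $M_n(\mathbb R)[t^{-1}]t^{-1}$ is written $x=\sum_{i\ge1}x_{-i}t^{-i}$ with $x_{-i}\in M_n(\mathbb R)$ (finitely many non-zero), and functions on it are written $f(x_{-1},x_{-2},\dots)$; $x_{-i}^{p,q}$ is the $(p,q)$-entry of $x_{-i}$. $\mathcal S(M_n(\mathbb R)[t^{-1}]t^{-1})$ is the space of complex-valued functions whose restriction to every finite-dimensional subspace is a Schwartz function, and $\mathcal S(M_n(\mathbb R)[t^{-1}]t^{-1})_\lambda$ is the subspace of $f$ with $\int_{M_n(\mathbb R)}f(y,x_{-1},x_{-2},\dots)\,dy=\lambda f(x_{-1},x_{-2},\dots)$. Functions on $M_n(\mathbb R)[t^{-1}]t^{-1}$ are extended to functions on $M_n(F)$ periodic under $M_n(\mathbb R[[t]])$ by pulling back along the projection $M_n(F)\to M_n(\mathbb R)[t^{-1}]t^{-1}$. This space carries an action of $\widehat{SL_n}(F)\times\widehat{SL_n}(F)$ (central extensions of the loop group $SL_n(F)$) coming from $x\mapsto g_1xg_2^T$; the restriction of the action $\pi_1$ of the first copy to $u\in SL_n(\mathbb R[[t]])$ (over which the extension is canonically split) is $\pi_1(u)f(x)=f(u^{-1}x)$. The dual action on linear functionals is $(\pi_1^*(u)\Psi)(f)=\Psi(\pi_1(u)^{-1}f)$. *)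

theory Defs
  imports
    "HOL-Analysis.Analysis"
    "HOL-Computational_Algebra.Formal_Laurent_Series"
    "HOL-Analysis.Finite_Function_Topology"
begin

text \<open>
  The field \<open>F = \<real>((t))\<close> is \<open>real fls\<close>, and \<open>M\<^sub>n(F)\<close> is \<open>real fls^'n^'n\<close> with \<open>n = CARD('n)\<close>.
  The index type is ordered, so that its elements can be numbered from \<open>1\<close> to \<open>n\<close>.
\<close>

definition ix :: "nat \<Rightarrow> 'n::{finite,wellorder}" where
  "ix k = sorted_list_of_set (UNIV :: 'n set) ! (k - 1)"

text \<open>
  The space \<open>M\<^sub>n(\<real>)[t\<^sup>-\<^sup>1]t\<^sup>-\<^sup>1\<close> consists of the finitely supported sequences of real matrices, where
  position \<open>i\<close> (counted from \<open>0\<close>) holds the coefficient of \<open>t\<close> to the power \<open>- (i + 1)\<close>.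
\<close>

type_synonym 'n polar = "nat \<Rightarrow>\<^sub>0 (real^'n^'n)"

text \<open>\<open>pcons y x\<close> is the sequence \<open>(y, x\<^sub>-\<^sub>1, x\<^sub>-\<^sub>2, \<dots>)\<close>.\<close>

lift_definition pcons :: "real^'n^'n \<Rightarrow> ('n::finite) polar \<Rightarrow> 'n polar"
  is "\<lambda>y x i. case i of 0 \<Rightarrow> y | Suc j \<Rightarrow> x j"
proof -
  fix y :: "real^'n^'n" and x :: "nat \<Rightarrow> real^'n^'n"
  assume "finite {i. x i \<noteq> 0}"
  moreover have "{i. (case i of 0 \<Rightarrow> y | Suc j \<Rightarrow> x j) \<noteq> 0} \<subseteq> insert 0 (Suc ` {i. x i \<noteq> 0})"
  proof
    fix i assume "i \<in> {i. (case i of 0 \<Rightarrow> y | Suc j \<Rightarrow> x j) \<noteq> 0}"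
    then show "i \<in> insert 0 (Suc ` {i. x i \<noteq> 0})" by (cases i) auto
  qed
  ultimately show "finite {i. (case i of 0 \<Rightarrow> y | Suc j \<Rightarrow> x j) \<noteq> 0}"
    by (meson finite_imageI finite_insert finite_subset)
qed

definition polar_emb :: "('n::finite) polar \<Rightarrow> real fls^'n^'n" where
  "polar_emb x = (\<chi> p q. \<Sum>i\<in>Poly_Mapping.keys x.
     fls_const (Poly_Mapping.lookup x i $ p $ q) * fls_X_intpow (- (int i + 1)))"

lift_definition polar_proj :: "real fls^'n^'n \<Rightarrow> ('n::finite) polar"
  is "\<lambda>X i. \<chi> p q. fls_nth (X $ p $ q) (- (int i + 1))"
proof -
  fix X :: "real fls^'n^'n"
  let ?N = "\<lambda>p q. {i. fls_nth (X $ p $ q) (- (int i + 1)) \<noteq> 0}"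
  have "finite (?N p q)" for p q
  proof (rule finite_subset)
    show "?N p q \<subseteq> {..nat (- fls_subdegree (X $ p $ q))}"
    proof
      fix i assume "i \<in> ?N p q"
      then have "fls_subdegree (X $ p $ q) \<le> - (int i + 1)"
        by (intro fls_subdegree_leI) simp
      then show "i \<in> {..nat (- fls_subdegree (X $ p $ q))}" by auto
    qed
  qed simp
  then have "finite (\<Union>p. \<Union>q. ?N p q)" by simp
  moreover have "{i. (\<chi> p q. fls_nth (X $ p $ q) (- (int i + 1))) \<noteq> 0} \<subseteq> (\<Union>p. \<Union>q. ?N p q)"
    by (auto simp: vec_eq_iff)
  ultimately show "finite {i. (\<chi> p q. fls_nth (X $ p $ q) (- (int i + 1))) \<noteq> 0}"
    by (rule finite_subset[rotated])
qed

text \<open>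
  Schwartz functions on a finite-dimensional subspace \<open>V\<close>, in a coordinate-free form: all iterated
  directional derivatives along \<open>V\<close> exist, are continuous and decrease rapidly on \<open>V\<close>.  Only the
  values of \<open>f\<close> on \<open>V\<close> matter.  The norm of the ambient space is irrelevant, since all norms on \<open>V\<close>
  are equivalent.
\<close>

definition dir_deriv :: "'a::real_vector \<Rightarrow> ('a \<Rightarrow> complex) \<Rightarrow> 'a \<Rightarrow> complex" where
  "dir_deriv v f x = vector_derivative (\<lambda>s. f (x + s *\<^sub>R v)) (at 0)"

definition schwartz_on :: "'a::real_normed_vector set \<Rightarrow> ('a \<Rightarrow> complex) \<Rightarrow> bool" where
  "schwartz_on V f \<longleftrightarrow> (\<forall>vs. set vs \<subseteq> V \<longrightarrow>
     (let g = foldr dir_deriv vs f in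
        continuous_on V g \<and>
        (\<forall>x\<in>V. \<forall>v\<in>V. (\<lambda>s::real. g (x + s *\<^sub>R v)) differentiable (at 0)) \<and>
        (\<forall>k::nat. \<exists>C. \<forall>x\<in>V. norm x ^ k * norm (g x) \<le> C)))"

definition schwartz_space :: "(('n::finite) polar \<Rightarrow> complex) set" where
  "schwartz_space = {f. \<forall>V. subspace V \<and> (\<exists>B. finite B \<and> V = span B) \<longrightarrow> schwartz_on V f}"

definition schwartz_eig :: "complex \<Rightarrow> (('n::finite) polar \<Rightarrow> complex) set" where
  "schwartz_eig lam = {f \<in> schwartz_space.
     \<forall>x. (LINT y|lborel. f (pcons y x)) = lam * f x}"

definition periodic_ext :: "(('n::finite) polar \<Rightarrow> complex) \<Rightarrow> real fls^'n^'n \<Rightarrow> complex" where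
  "periodic_ext f X = f (polar_proj X)"

definition SL_power_series :: "(real fls^'n^'n) set" where
  "SL_power_series = {u. det u = 1 \<and> (\<forall>p q. \<forall>k<0. fls_nth (u $ p $ q) k = 0)}"

definition unipotent_at_0 :: "real fls^'n::{finite,wellorder}^'n::{finite,wellorder} \<Rightarrow> bool" where
  "unipotent_at_0 u \<longleftrightarrow>
     (\<forall>p. fls_nth (u $ p $ p) 0 = 1) \<and> (\<forall>p q. q < p \<longrightarrow> fls_nth (u $ p $ q) 0 = 0)"

definition pi1 :: "real fls^'n^'n \<Rightarrow> (('n::finite) polar \<Rightarrow> complex) \<Rightarrow> 'n polar \<Rightarrow> complex" where
  "pi1 u f x = periodic_ext f (matrix_inv u ** polar_emb x)"

text \<open>
  For \<open>u\<close> in \<open>SL\<^sub>n(\<real>[[t]])\<close> the operator \<open>pi1 u\<close> is a bijection on the space of all functions, so \<open>inv\<close>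
  below is its inverse.
\<close>

definition pi1_dual :: "real fls^'n^'n \<Rightarrow> ((('n::finite) polar \<Rightarrow> complex) \<Rightarrow> complex)
    \<Rightarrow> ('n polar \<Rightarrow> complex) \<Rightarrow> complex" where
  "pi1_dual u \<Psi> f = \<Psi> (inv (pi1 u) f)"

text \<open>Positions of the entries on, above, or immediately below the diagonal.\<close>

definition hess :: "('n::{finite,wellorder} \<times> 'n) set" where
  "hess = {(ix p, ix q) |p q. p \<in> {1..CARD('n)} \<and> q \<in> {1..CARD('n)} \<and> p \<le> q + 1}"

text \<open>
  A point of the domain of integration is a pair \<open>(x, z)\<close>: the family \<open>x\<close> of Hessenberg entries of
  the coefficient of \<open>t\<^sup>-\<^sup>1\<close>, and the \<open>(1,n)\<close>-entry \<open>z\<close> of the coefficient of \<open>t\<^sup>-\<^sup>2\<close>.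
\<close>

definition hess_measure :: "((('n::{finite,wellorder} \<times> 'n) \<Rightarrow> real) \<times> real) measure" where
  "hess_measure = PiM hess (\<lambda>_. lborel) \<Otimes>\<^sub>M lborel"

definition hess_point :: "(('n::{finite,wellorder} \<times> 'n) \<Rightarrow> real) \<times> real \<Rightarrow> 'n polar" where
  "hess_point = (\<lambda>(x, z).
     pcons (\<chi> p q. if (p, q) \<in> hess then x (p, q) else 0)
       (pcons (\<chi> p q. if p = ix 1 \<and> q = ix (CARD('n)) then z else 0) 0))"

text \<open>Vanishing denominators, where HOL division gives \<open>0\<close>, only occur on a null set.\<close>

definition psi_phase :: "real^'n::{finite,wellorder} \<Rightarrow> (('n \<times> 'n) \<Rightarrow> real) \<times> real \<Rightarrow> real" where
  "psi_phase c = (\<lambda>(x, z).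
     (\<Sum>k=1..CARD('n) - 1. c $ ix k * (x (ix k, ix k) / x (ix (k + 1), ix k)))
     + c $ ix (CARD('n)) * (x (ix (CARD('n)), ix (CARD('n))) / z))"

definition psi_integrand :: "real^'n::{finite,wellorder} \<Rightarrow> ('n polar \<Rightarrow> complex)
    \<Rightarrow> (('n \<times> 'n) \<Rightarrow> real) \<times> real \<Rightarrow> complex" where
  "psi_integrand c f w =
     f (hess_point w) * exp (2 * complex_of_real pi * \<i> * complex_of_real (psi_phase c w))"

definition psi :: "real^'n::{finite,wellorder} \<Rightarrow> ('n polar \<Rightarrow> complex) \<Rightarrow> complex" where
  "psi c f = (LINT w|hess_measure. psi_integrand c f w)"

definition chi_hat :: "real^'n::{finite,wellorder} \<Rightarrow>
    real fls^'n::{finite,wellorder}^'n::{finite,wellorder} \<Rightarrow> complex" where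
  "chi_hat c u = exp (- (2 * complex_of_real pi * \<i> * complex_of_real
     ((\<Sum>k=1..CARD('n) - 1. c $ ix k * fls_nth (u $ ix k $ ix (k + 1)) 0)
      + c $ ix (CARD('n)) * fls_nth (u $ ix (CARD('n)) $ ix 1) 1)))"

definition linear_functional_on :: "('a \<Rightarrow> complex) set \<Rightarrow> (('a \<Rightarrow> complex) \<Rightarrow> complex) \<Rightarrow> bool" where
  "linear_functional_on S \<Psi> \<longleftrightarrow>
     (\<forall>f\<in>S. \<forall>g\<in>S. \<forall>a b. \<Psi> (\<lambda>x. a * f x + b * g x) = a * \<Psi> f + b * \<Psi> g)"

end

theory Submission
  imports Defs "HOL-Probability.Sinc_Integral"
begin

text \<open>
  The idea is a change of variables.  On \<open>X = A t\<^sup>-\<^sup>1 + B t\<^sup>-\<^sup>2\<close> with \<open>A\<close> upper Hessenberg and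
  \<open>B = z E\<^sub>1\<^sub>n\<close>, the polar part of \<open>u X\<close> is \<open>(U A + V B) t\<^sup>-\<^sup>1 + U B t\<^sup>-\<^sup>2\<close>, where
  \<open>U = u(0)\<close> is upper triangular unipotent and \<open>V = u'(0)\<close>.  This is again a point of the domain of
  integration: \<open>U A\<close> is Hessenberg, \<open>U B = B\<close>, and \<open>V B\<close> only has entries in the last column
  (\<open>hess_act_matrix\<close>).  The resulting map on the coordinates is triangular with ones on the
  diagonal, so it preserves Lebesgue measure (\<open>hess_act_preserves_hess_measure\<close>).  It adds to each of the \<open>n\<close>
  quotients in the phase a constant, namely a superdiagonal entry of \<open>U\<close> or the entry \<open>(n, 1)\<close> of \<open>V\<close>
  (\<open>psi_phase_hess_act\<close>).  These constants make up the character.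

  Two points surround this computation.  The dual action involves the inverse of the operator
  \<open>pi1 u\<close>.  That inverse is the translation \<open>f \<mapsto> (x \<mapsto> f (u x))\<close>, because the matrices \<open>u\<close> and
  \<open>u\<^sup>-\<^sup>1\<close> both have power series entries (\<open>inv_pi1\<close>).  The integrals converge absolutely, because a Schwartz function on a
  finite-dimensional space is bounded by a multiple of the product of the integrable functions
  \<open>1 / (1 + t\<^sup>2)\<close> of the coordinates (\<open>schwartz_hess_point_bound\<close>); linearity of the functional follows.
\<close>

no_notation fps_nth (infixl \<open>$\<close> 75)

section \<open>Matrices over power series\<close>

lemma range_fps_to_fls_iff: "a \<in> range fps_to_fls \<longleftrightarrow> (\<forall>k<0. fls_nth a k = 0)"
proof
  assume "\<forall>k<0. fls_nth a k = 0"
  then have "a = fps_to_fls (fls_regpart a)"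
    by (intro fls_eqI) simp
  then show "a \<in> range fps_to_fls" by blast
qed auto

lemma range_fps_to_fls_mult:
  fixes a b :: "'a::semiring_1 fls"
  assumes "a \<in> range fps_to_fls" "b \<in> range fps_to_fls"
  shows "a * b \<in> range fps_to_fls"
  using assms by (auto simp flip: fls_times_fps_to_fls)

lemma range_fps_to_fls_sum:
  fixes g :: "'b \<Rightarrow> 'a::ring_1 fls"
  assumes "\<And>i. i \<in> S \<Longrightarrow> g i \<in> range fps_to_fls"
  shows "sum g S \<in> range fps_to_fls"
  using assms by (simp add: range_fps_to_fls_iff fls_nth_sum)

lemma range_fps_to_fls_prod:
  fixes g :: "'b \<Rightarrow> 'a::comm_ring_1 fls"
  assumes "\<And>i. i \<in> S \<Longrightarrow> g i \<in> range fps_to_fls"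
  shows "prod g S \<in> range fps_to_fls"
  using assms
proof (induction S rule: infinite_finite_induct)
  case (insert x S)
  then show ?case by (simp add: range_fps_to_fls_mult)
qed (simp_all add: range_fps_to_fls_iff)

definition integral_mat :: "'a::comm_ring_1 fls^'n^'m \<Rightarrow> bool" where
  "integral_mat A \<longleftrightarrow> (\<forall>p q. A $ p $ q \<in> range fps_to_fls)"

lemma integral_mat_mult:
  "integral_mat A \<Longrightarrow> integral_mat B \<Longrightarrow> integral_mat (A ** B)"
  unfolding integral_mat_def matrix_matrix_mult_def
  by (auto intro!: range_fps_to_fls_sum range_fps_to_fls_mult)

lemma det_integral_mat:
  fixes A :: "'a::comm_ring_1 fls^'n^'n"
  assumes "integral_mat A"
  shows "det A \<in> range fps_to_fls"
proof -
  have "(of_int k :: 'a fls) \<in> range fps_to_fls" for k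
    by (simp add: range_fps_to_fls_iff fls_of_int_nth)
  then show ?thesis
    using assms unfolding det_def integral_mat_def
    by (intro range_fps_to_fls_sum range_fps_to_fls_mult range_fps_to_fls_prod) auto
qed

lemma matrix_inv_inverse:
  fixes A :: "'a::field^'n^'n"
  assumes "det A \<noteq> 0"
  shows "A ** matrix_inv A = mat 1" "matrix_inv A ** A = mat 1"
proof -
  have "\<exists>A'. A ** A' = mat 1 \<and> A' ** A = mat 1"
    using assms by (simp add: invertible_def flip: invertible_det_nz)
  then have "A ** matrix_inv A = mat 1 \<and> matrix_inv A ** A = mat 1"
    unfolding matrix_inv_def by (rule someI_ex)
  then show "A ** matrix_inv A = mat 1" "matrix_inv A ** A = mat 1" by auto
qed

text \<open>
  By Cramer's rule the entries of the inverse are determinants of integral matrices, because the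
  denominator \<open>det u\<close> is \<open>1\<close>.
\<close>

lemma integral_matrix_inv:
  fixes u :: "'a::field fls^'n^'n"
  assumes "integral_mat u" and "det u = 1"
  shows "integral_mat (matrix_inv u)"
  unfolding integral_mat_def
proof (intro allI)
  fix p q :: 'n
  let ?e = "axis q 1 :: 'a fls^'n"
  have "u *v (matrix_inv u *v ?e) = ?e"
    using assms(2) by (simp add: matrix_vector_mul_assoc matrix_inv_inverse)
  then have "matrix_inv u *v ?e = (\<chi> k. det (\<chi> i j. if j = k then ?e $ i else u $ i $ j))"
    using cramer[of u "matrix_inv u *v ?e" ?e] assms(2) by simp
  moreover have "matrix_inv u $ p $ q = (matrix_inv u *v ?e) $ p"
    by (simp add: matrix_vector_mult_def axis_def if_distrib cong: if_cong)
  ultimately have "matrix_inv u $ p $ q = det (\<chi> i j. if j = p then ?e $ i else u $ i $ j)"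
    by simp
  moreover have "(1 :: 'a fls) \<in> range fps_to_fls" "(0 :: 'a fls) \<in> range fps_to_fls"
    by (simp_all add: range_fps_to_fls_iff)
  then have "integral_mat (\<chi> i j. if j = p then ?e $ i else u $ i $ j)"
    using assms(1) by (simp add: integral_mat_def axis_def)
  ultimately show "matrix_inv u $ p $ q \<in> range fps_to_fls"
    by (simp add: det_integral_mat)
qed

lemma SL_power_series_iff: "u \<in> SL_power_series \<longleftrightarrow> integral_mat u \<and> det u = 1"
  by (auto simp: SL_power_series_def integral_mat_def range_fps_to_fls_iff)

section \<open>Left multiplication on polar parts\<close>

lemma lookup_polar_proj:
  "Poly_Mapping.lookup (polar_proj X) i $ p $ q = fls_nth (X $ p $ q) (- (int i + 1))"
  by (simp add: polar_proj.rep_eq)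

lemma nth_polar_emb:
  "fls_nth (polar_emb x $ p $ q) k = (if k < 0 then Poly_Mapping.lookup x (nat (- k - 1)) $ p $ q else 0)"
proof -
  have "fls_nth (polar_emb x $ p $ q) k =
      (\<Sum>i\<in>Poly_Mapping.keys x. if k = - (int i + 1) then Poly_Mapping.lookup x i $ p $ q else 0)"
    by (simp add: polar_emb_def fls_nth_sum fls_X_intpow_times_conv_shift)
       (auto intro!: sum.cong)
  also have "\<dots> = (if k < 0 then Poly_Mapping.lookup x (nat (- k - 1)) $ p $ q else 0)"
  proof (cases "k < 0")
    case True
    then have "(k = - (int i + 1)) = (i = nat (- k - 1))" for i by auto
    then show ?thesis
      using True by (auto simp: sum.delta in_keys_iff)
  qed (auto intro!: sum.neutral)
  finally show ?thesis .
qed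

lemma polar_proj_emb: "polar_proj (polar_emb x) = x"
  by (rule poly_mapping_eqI) (simp add: vec_eq_iff lookup_polar_proj nth_polar_emb)

lemma polar_proj_eqI:
  assumes "integral_mat (X - Y)"
  shows "polar_proj X = polar_proj Y"
  using assms
  by (intro poly_mapping_eqI) (auto simp: vec_eq_iff lookup_polar_proj integral_mat_def range_fps_to_fls_iff)

text \<open>
  Truncating to the polar part changes a matrix by an integral one, and an integral factor \<open>u\<close> keeps
  that change integral.  This makes left multiplication an action of the integral matrices on polar
  parts.
\<close>

lemma polar_proj_mult_emb_proj:
  assumes "integral_mat u"
  shows "polar_proj (u ** polar_emb (polar_proj Y)) = polar_proj (u ** Y)"
proof (rule polar_proj_eqI)
  have "integral_mat (polar_emb (polar_proj Y) - Y)"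
    by (simp add: integral_mat_def range_fps_to_fls_iff nth_polar_emb lookup_polar_proj)
  then have "integral_mat (u ** (polar_emb (polar_proj Y) - Y))"
    using assms by (rule integral_mat_mult[rotated])
  then show "integral_mat (u ** polar_emb (polar_proj Y) - u ** Y)"
    by (simp add: matrix_matrix_mult_def vec_eq_iff integral_mat_def right_diff_distrib sum_subtractf)
qed

text \<open>
  Both \<open>u\<close> and \<open>matrix_inv u\<close> are integral, so the translations by them compose as the matrices do.
  Since \<open>pi1 u\<close> is translation by \<open>matrix_inv u\<close>, its inverse is translation by \<open>u\<close>.
\<close>

lemma inv_pi1:
  fixes u :: "real fls^'n^'n"
  assumes "u \<in> SL_power_series"
  shows "inv (pi1 u) = (\<lambda>f x. f (polar_proj (u ** polar_emb x)))"
proof -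
  have u: "integral_mat u" "det u = 1"
    using assms by (simp_all add: SL_power_series_iff)
  have inv: "u ** matrix_inv u = mat 1" "matrix_inv u ** u = mat 1"
    using u(2) by (simp_all add: matrix_inv_inverse)
  show ?thesis
    by (intro inv_unique_comp)
      (simp_all add: fun_eq_iff pi1_def periodic_ext_def polar_proj_mult_emb_proj u
        integral_matrix_inv matrix_mul_assoc inv polar_proj_emb)
qed

lemma pi1_dual_eq:
  assumes "u \<in> SL_power_series"
  shows "pi1_dual u \<Psi> f = \<Psi> (\<lambda>x. f (polar_proj (u ** polar_emb x)))"
  by (simp add: pi1_dual_def inv_pi1[OF assms])

lemma lookup_pcons:
  "Poly_Mapping.lookup (pcons y x) i = (case i of 0 \<Rightarrow> y | Suc j \<Rightarrow> Poly_Mapping.lookup x j)"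
  by (simp add: pcons.rep_eq)

definition fls_mat_coeff :: "'a::zero fls^'n^'m \<Rightarrow> int \<Rightarrow> 'a^'n^'m" where
  "fls_mat_coeff u k = (\<chi> p q. fls_nth (u $ p $ q) k)"

lemma polar_emb_two_terms:
  "polar_emb (pcons A (pcons B 0)) $ r $ q =
     fls_const (A $ r $ q) * fls_X_intpow (- 1) + fls_const (B $ r $ q) * fls_X_intpow (- 2)"
proof (rule fls_eqI)
  fix k :: int
  consider "k \<ge> 0" | "k = - 1" | "k = - 2" | "k < - 2" by linarith
  then show "fls_nth (polar_emb (pcons A (pcons B 0)) $ r $ q) k =
     fls_nth (fls_const (A $ r $ q) * fls_X_intpow (- 1) + fls_const (B $ r $ q) * fls_X_intpow (- 2)) k"
    by cases (auto simp: nth_polar_emb lookup_pcons fls_X_intpow_times_conv_shift split: nat.split)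
qed

lemma nth_mult_polar_emb:
  "fls_nth (f * polar_emb (pcons A (pcons B 0)) $ r $ q) k
    = fls_nth f (k + 1) * A $ r $ q + fls_nth f (k + 2) * B $ r $ q"
proof -
  have "f * polar_emb (pcons A (pcons B 0)) $ r $ q =
      (f * fls_const (A $ r $ q)) * fls_X_intpow (- 1) + (f * fls_const (B $ r $ q)) * fls_X_intpow (- 2)"
    by (simp only: polar_emb_two_terms distrib_left mult.assoc)
  then show ?thesis
    by (simp only: fls_X_intpow_times_conv_shift fls_plus_nth fls_shift_nth) simp
qed

text \<open>
  Only the first two coefficients of \<open>u\<close> act on \<open>A t\<^sup>-\<^sup>1 + B t\<^sup>-\<^sup>2\<close>: higher powers of \<open>t\<close> land in the
  power series.
\<close>

lemma polar_proj_mult_two_terms: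
  assumes "integral_mat u"
  shows "polar_proj (u ** polar_emb (pcons A (pcons B 0))) =
    pcons (fls_mat_coeff u 0 ** A + fls_mat_coeff u 1 ** B) (pcons (fls_mat_coeff u 0 ** B) 0)"
proof (rule poly_mapping_eqI)
  fix i
  have u: "fls_nth (u $ p $ q) k = 0" if "k < 0" for p q k
    using assms that by (simp add: integral_mat_def range_fps_to_fls_iff)
  show "Poly_Mapping.lookup (polar_proj (u ** polar_emb (pcons A (pcons B 0)))) i =
     Poly_Mapping.lookup (pcons (fls_mat_coeff u 0 ** A + fls_mat_coeff u 1 ** B)
       (pcons (fls_mat_coeff u 0 ** B) 0)) i"
    by (simp add: vec_eq_iff lookup_polar_proj lookup_pcons matrix_matrix_mult_def fls_nth_sum
        nth_mult_polar_emb fls_mat_coeff_def u sum.distrib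
        split: nat.split)
qed

section \<open>Hessenberg positions\<close>

lemma ix_less_iff:
  assumes "i \<in> {1..CARD('n)}" "j \<in> {1..CARD('n)}"
  shows "(ix i :: 'n::{finite,wellorder}) < ix j \<longleftrightarrow> i < j"
proof -
  let ?L = "sorted_list_of_set (UNIV :: 'n set)"
  have "sorted_wrt (<) ?L" "length ?L = CARD('n)" by auto
  then have mono: "?L ! k < ?L ! l" if "k < l" "l < CARD('n)" for k l
    using that by (metis sorted_wrt_nth_less)
  have "(ix i :: 'n) < ix j" if "i < j" "1 \<le> i" "j \<le> CARD('n)" for i j
    unfolding ix_def using that by (intro mono) auto
  then show ?thesis
    using assms by (metis atLeastAtMost_iff linorder_less_linear order_less_asym)
qed

lemma ix_eq_iff:
  assumes "i \<in> {1..CARD('n)}" "j \<in> {1..CARD('n)}"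
  shows "(ix i :: 'n::{finite,wellorder}) = ix j \<longleftrightarrow> i = j"
  using ix_less_iff[OF assms] ix_less_iff[OF assms(2,1)] by (metis linorder_neq_iff)

lemma ix_cases:
  fixes q :: "'n::{finite,wellorder}"
  obtains k where "k \<in> {1..CARD('n)}" "q = ix k"
proof -
  let ?L = "sorted_list_of_set (UNIV :: 'n set)"
  have "q \<in> set ?L" by simp
  then obtain k where "k < length ?L" "?L ! k = q" by (metis in_set_conv_nth)
  then show thesis using that[of "Suc k"] by (simp add: ix_def)
qed

lemma hess_ix_iff:
  assumes "i \<in> {1..CARD('n)}" "j \<in> {1..CARD('n)}"
  shows "(ix i :: 'n::{finite,wellorder}, ix j) \<in> hess \<longleftrightarrow> i \<le> j + 1"
  using assms ix_eq_iff unfolding hess_def by (auto simp: ix_eq_iff)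

lemma hess_upward:
  fixes p r q :: "'n::{finite,wellorder}"
  assumes "(r, q) \<in> hess" "p \<le> r"
  shows "(p, q) \<in> hess"
  using assms
  by (cases p rule: ix_cases; cases r rule: ix_cases; cases q rule: ix_cases)
     (auto simp: hess_ix_iff ix_less_iff simp flip: not_less)

lemma ix_last_greatest: "p \<le> (ix (CARD('n)) :: 'n::{finite,wellorder})"
  by (cases p rule: ix_cases) (auto simp: ix_less_iff simp flip: not_less)

lemma ix_first_least: "ix 1 \<le> (p :: 'n::{finite,wellorder})"
  by (cases p rule: ix_cases) (auto simp: ix_less_iff simp flip: not_less)

lemma hess_last_column: "(p :: 'n::{finite,wellorder}, ix (CARD('n))) \<in> hess"
  by (cases p rule: ix_cases) (auto simp: hess_ix_iff)

section \<open>Measure-preserving triangular maps\<close>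

lemma (in product_sigma_finite) nn_integral_pull_component:
  assumes "finite I" "i \<in> I" and f: "f \<in> borel_measurable (Pi\<^sub>M I M)"
  shows "integral\<^sup>N (Pi\<^sub>M I M) f = (\<integral>\<^sup>+ x. (\<integral>\<^sup>+ y. f (x(i := y)) \<partial>(M i)) \<partial>(Pi\<^sub>M (I - {i}) M))"
  using product_nn_integral_insert[of "I - {i}" i f] assms by (simp add: insert_absorb)

interpretation lborel_product: product_sigma_finite "\<lambda>_. lborel :: real measure" ..

lemma nn_integral_lborel_translate:
  fixes f :: "real \<Rightarrow> ennreal"
  assumes "f \<in> borel_measurable borel"
  shows "(\<integral>\<^sup>+ y. f (y + c) \<partial>lborel) = (\<integral>\<^sup>+ y. f y \<partial>lborel)"
  using nn_integral_real_affine[of f 1 c] assms by (simp add: add.commute)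

text \<open>
  Integrating over the coordinate \<open>m\<close> first, a shear along \<open>m\<close> is a translation of \<open>\<real>\<close> by an amount that
  is constant for that inner integral.
\<close>

lemma distr_shear_PiM_lborel:
  fixes \<phi> :: "('i \<Rightarrow> real) \<Rightarrow> real"
  assumes I: "finite I" "m \<in> I"
    and [measurable]: "\<phi> \<in> borel_measurable (PiM I (\<lambda>_. lborel))"
    and indep: "\<And>x y. \<phi> (x(m := y)) = \<phi> x"
  shows "(\<lambda>x. x(m := x m + \<phi> x)) \<in> PiM I (\<lambda>_. lborel) \<rightarrow>\<^sub>M PiM I (\<lambda>_. lborel)" (is "?T \<in> _")
    and "distr (PiM I (\<lambda>_. lborel)) (PiM I (\<lambda>_. lborel)) (\<lambda>x. x(m := x m + \<phi> x)) = PiM I (\<lambda>_. lborel)"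
proof -
  let ?M = "PiM I (\<lambda>_. lborel :: real measure)"
  have [measurable]: "(\<lambda>x. x m) \<in> borel_measurable ?M"
    using I measurable_component_singleton[of m I "\<lambda>_. lborel"] by simp
  show T[measurable]: "?T \<in> ?M \<rightarrow>\<^sub>M ?M"
  proof (rule measurable_PiM_single')
    show "(\<lambda>x. ?T x i) \<in> ?M \<rightarrow>\<^sub>M lborel" if "i \<in> I" for i
    proof (cases "i = m")
      case False
      then show ?thesis
        using measurable_component_singleton[OF that, of "\<lambda>_. lborel"] by simp
    qed simp
    show "?T \<in> space ?M \<rightarrow> I \<rightarrow>\<^sub>E space lborel"
      using I by (auto simp: space_PiM PiE_def extensional_def)
  qed
  show "distr ?M ?M ?T = ?M"
  proof (rule measure_eqI)
    fix A assume "A \<in> sets (distr ?M ?M ?T)"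
    then have A[measurable]: "A \<in> sets ?M" by simp
    have fun_upd[measurable]: "(\<lambda>y. x(m := y)) \<in> borel \<rightarrow>\<^sub>M ?M"
      if "x \<in> space (PiM (I - {m}) (\<lambda>_. lborel :: real measure))" for x
      using measurable_component_update[OF that, of m] I by (simp add: insert_absorb)
    have "emeasure (distr ?M ?M ?T) A = (\<integral>\<^sup>+ x. indicator A (?T x) \<partial>?M)"
      by (simp add: nn_integral_distr flip: nn_integral_indicator)
    also have "\<dots> = (\<integral>\<^sup>+ x. (\<integral>\<^sup>+ y. indicator A (?T (x(m := y))) \<partial>lborel) \<partial>(PiM (I - {m}) (\<lambda>_. lborel)))"
      by (rule lborel_product.nn_integral_pull_component[OF I]) simp
    also have "\<dots> = (\<integral>\<^sup>+ x. (\<integral>\<^sup>+ y. indicator A (x(m := y)) \<partial>lborel) \<partial>(PiM (I - {m}) (\<lambda>_. lborel)))"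
    proof (rule nn_integral_cong)
      fix x assume x: "x \<in> space (PiM (I - {m}) (\<lambda>_. lborel :: real measure))"
      have "(\<integral>\<^sup>+ y. indicator A (?T (x(m := y))) \<partial>lborel) = (\<integral>\<^sup>+ y. indicator A (x(m := y + \<phi> x)) \<partial>lborel)"
        by (simp add: indep)
      also have "\<dots> = (\<integral>\<^sup>+ y. indicator A (x(m := y)) \<partial>lborel)"
        using fun_upd[OF x] by (intro nn_integral_lborel_translate) simp
      finally show "(\<integral>\<^sup>+ y. indicator A (?T (x(m := y))) \<partial>lborel) = (\<integral>\<^sup>+ y. indicator A (x(m := y)) \<partial>lborel)" .
    qed
    also have "\<dots> = (\<integral>\<^sup>+ x. indicator A x \<partial>?M)"
      by (rule lborel_product.nn_integral_pull_component[OF I, symmetric]) simp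
    finally show "emeasure (distr ?M ?M ?T) A = emeasure ?M A" by simp
  qed simp
qed

text \<open>
  The coordinates that \<open>\<phi> i\<close> reads all have larger rank than \<open>i\<close>.  Hence the map is the composition of
  the shears along the single coordinates, performed in order of increasing rank: when coordinate \<open>m\<close>
  is updated, the coordinates read by \<open>\<phi> m\<close> still have their old values.
\<close>

lemma distr_triangular_PiM_lborel:
  fixes \<phi> :: "'i \<Rightarrow> ('i \<Rightarrow> real) \<Rightarrow> real" and rk :: "'i \<Rightarrow> 'r::linorder"
  assumes I: "finite I" and meas: "\<And>i. i \<in> I \<Longrightarrow> \<phi> i \<in> borel_measurable (PiM I (\<lambda>_. lborel))"
    and dep: "\<And>i x y. (\<And>j. rk i < rk j \<Longrightarrow> x j = y j) \<Longrightarrow> \<phi> i x = \<phi> i y"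
  shows "distr (PiM I (\<lambda>_. lborel)) (PiM I (\<lambda>_. lborel)) (\<lambda>x. \<lambda>i\<in>I. x i + \<phi> i x) = PiM I (\<lambda>_. lborel)"
proof -
  let ?M = "PiM I (\<lambda>_. lborel :: real measure)"
  define T where "T S x = (\<lambda>i. if i \<in> S then x i + \<phi> i x else x i)" for S x
  have "S \<subseteq> I \<longrightarrow> T S \<in> ?M \<rightarrow>\<^sub>M ?M \<and> distr ?M ?M (T S) = ?M" if "finite S" for S
    using that
  proof (induction S rule: finite_ranking_induct[where f = rk])
    case empty
    have "T {} = (\<lambda>x. x)" by (simp add: T_def fun_eq_iff)
    then show ?case by (simp add: distr_id)
  next
    case (insert m S)
    show ?case
    proof (cases "m \<in> S")
      case True
      then show ?thesis using insert.IH by (simp add: insert_absorb)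
    next
      case False
      show ?thesis
      proof
        assume sub: "insert m S \<subseteq> I"
        then have m: "m \<in> I" and IH: "T S \<in> ?M \<rightarrow>\<^sub>M ?M" "distr ?M ?M (T S) = ?M"
          using insert.IH by auto
        let ?U = "\<lambda>x. x(m := x m + \<phi> m x)"
        have "\<phi> m (x(m := y)) = \<phi> m x" for x y
          by (rule dep) auto
        note U = distr_shear_PiM_lborel[OF I m meas[OF m] this]
        have "\<phi> m (T S x) = \<phi> m x" for x
          using insert.hyps by (intro dep) (auto simp: T_def dest: leD)
        then have eq: "T (insert m S) = ?U \<circ> T S"
          using False by (auto simp: fun_eq_iff T_def)
        show "T (insert m S) \<in> ?M \<rightarrow>\<^sub>M ?M \<and> distr ?M ?M (T (insert m S)) = ?M"
          unfolding eq using IH U by (simp add: measurable_comp flip: distr_distr)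
      qed
    qed
  qed
  then have T: "distr ?M ?M (T I) = ?M"
    using I by auto
  have eq: "(\<lambda>i\<in>I. x i + \<phi> i x) = T I x" if "x \<in> space ?M" for x
    using that by (auto simp: T_def space_PiM PiE_def extensional_def fun_eq_iff)
  show "distr ?M ?M (\<lambda>x. \<lambda>i\<in>I. x i + \<phi> i x) = ?M"
    using T by (subst distr_cong[OF refl refl eq]) auto
qed

lemma AE_PiM_lborel_neq:
  fixes a :: real
  assumes "finite I" "i \<in> I"
  shows "AE x in PiM I (\<lambda>_. lborel). x i \<noteq> a"
proof (rule AE_I)
  let ?N = "PiE I (\<lambda>j. if j = i then {a} else UNIV)"
  show "{x \<in> space (PiM I (\<lambda>_. lborel)). \<not> x i \<noteq> a} \<subseteq> ?N"
    by (auto simp: space_PiM PiE_iff extensional_def)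
  show "?N \<in> sets (PiM I (\<lambda>_. lborel))"
    using assms by (intro sets_PiM_I_finite) auto
  show "emeasure (PiM I (\<lambda>_. lborel)) ?N = 0"
    using assms by (subst lborel_product.emeasure_PiM) (auto intro!: prod_zero bexI[of _ i])
qed

lemma nn_integral_inverse_1_plus_square_finite:
  "(\<integral>\<^sup>+ x. ennreal (1 / (1 + x\<^sup>2)) \<partial>lborel) < \<infinity>"
proof -
  have "integrable lborel (\<lambda>x::real. 1 / (1 + x\<^sup>2))"
    using integrable_inverse_1_plus_square by (simp add: set_integrable_def divide_inverse)
  then show ?thesis by (simp add: integrable_iff_bounded)
qed

lemma distr_fibrewise_pair:
  assumes "sigma_finite_measure M" "sigma_finite_measure N"
    and T: "(\<lambda>(x, z). T z x) \<in> M \<Otimes>\<^sub>M N \<rightarrow>\<^sub>M M"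
    and pres: "\<And>z. z \<in> space N \<Longrightarrow> distr M M (T z) = M"
  shows "distr (M \<Otimes>\<^sub>M N) (M \<Otimes>\<^sub>M N) (\<lambda>(x, z). (T z x, z)) = M \<Otimes>\<^sub>M N"
proof (rule measure_eqI)
  interpret pair_sigma_finite M N
    using assms by (simp add: pair_sigma_finite_def)
  have T2: "(\<lambda>(x, z). (T z x, z)) \<in> M \<Otimes>\<^sub>M N \<rightarrow>\<^sub>M M \<Otimes>\<^sub>M N"
    using measurable_Pair[OF T measurable_snd] by (simp add: case_prod_beta')
  fix A assume "A \<in> sets (distr (M \<Otimes>\<^sub>M N) (M \<Otimes>\<^sub>M N) (\<lambda>(x, z). (T z x, z)))"
  then have A[measurable]: "A \<in> sets (M \<Otimes>\<^sub>M N)" by simp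
  have "emeasure (distr (M \<Otimes>\<^sub>M N) (M \<Otimes>\<^sub>M N) (\<lambda>(x, z). (T z x, z))) A
      = (\<integral>\<^sup>+ w. indicator A (T (snd w) (fst w), snd w) \<partial>(M \<Otimes>\<^sub>M N))"
    using T2 by (simp add: case_prod_beta' nn_integral_distr flip: nn_integral_indicator)
  also have "\<dots> = (\<integral>\<^sup>+ z. \<integral>\<^sup>+ x. indicator A (T z x, z) \<partial>M \<partial>N)"
    using T2 by (subst nn_integral_snd[of "\<lambda>w. indicator A (T (snd w) (fst w), snd w)", symmetric])
      (simp_all add: case_prod_beta')
  also have "\<dots> = (\<integral>\<^sup>+ z. \<integral>\<^sup>+ x. indicator A (x, z) \<partial>M \<partial>N)"
  proof (rule nn_integral_cong)
    fix z assume z: "z \<in> space N"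
    have [measurable]: "T z \<in> M \<rightarrow>\<^sub>M M"
      using measurable_compose[OF measurable_Pair2'[OF z] T] by simp
    have "(\<integral>\<^sup>+ x. indicator A (x, z) \<partial>M) = (\<integral>\<^sup>+ x. indicator A (x, z) \<partial>(distr M M (T z)))"
      by (simp add: pres z)
    also have "\<dots> = (\<integral>\<^sup>+ x. indicator A (T z x, z) \<partial>M)"
      using z by (intro nn_integral_distr) auto
    finally show "(\<integral>\<^sup>+ x. indicator A (T z x, z) \<partial>M) = (\<integral>\<^sup>+ x. indicator A (x, z) \<partial>M)" ..
  qed
  also have "\<dots> = emeasure (M \<Otimes>\<^sub>M N) A"
    using nn_integral_snd[of "indicator A"] by simp
  finally show "emeasure (distr (M \<Otimes>\<^sub>M N) (M \<Otimes>\<^sub>M N) (\<lambda>(x, z). (T z x, z))) A = emeasure (M \<Otimes>\<^sub>M N) A" .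
qed simp

section \<open>The action in Hessenberg coordinates\<close>

type_synonym 'n rmat = "real^'n^'n"

text \<open>
  Matrices \<open>U = u(0)\<close> and \<open>V = u'(0)\<close> act on \<open>A t\<^sup>-\<^sup>1 + B t\<^sup>-\<^sup>2\<close> by \<open>A \<mapsto> U A + V B\<close> and \<open>B \<mapsto> U B\<close>.  The next
  two definitions are this map written in the coordinates \<open>(x, z)\<close> of the domain of integration, for
  upper triangular unipotent \<open>U\<close>.  The sum is what the entries of \<open>U\<close> above its diagonal contribute to \<open>U A\<close>.  Since
  \<open>B\<close> has its only entry \<open>z\<close> in the corner \<open>(1, n)\<close>, the product \<open>V B\<close> is the first column of \<open>V\<close>, scaled by
  \<open>z\<close> and moved to the last column.
\<close>

definition hess_shift :: "'n rmat \<Rightarrow> 'n rmat \<Rightarrow> real \<Rightarrow> 'n \<times> 'n \<Rightarrow>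
    ('n::{finite,wellorder} \<times> 'n \<Rightarrow> real) \<Rightarrow> real" where
  "hess_shift U V z = (\<lambda>(p, q) x. (\<Sum>r | p < r \<and> (r, q) \<in> hess. U $ p $ r * x (r, q))
     + (if q = ix (CARD('n)) then z * V $ p $ ix 1 else 0))"

definition hess_act :: "'n rmat \<Rightarrow> 'n rmat \<Rightarrow>
    ('n::{finite,wellorder} \<times> 'n \<Rightarrow> real) \<times> real \<Rightarrow> ('n \<times> 'n \<Rightarrow> real) \<times> real" where
  "hess_act U V = (\<lambda>(x, z). (\<lambda>i\<in>hess. x i + hess_shift U V z i x, z))"

definition upper_unipotent :: "'n::{finite,wellorder} rmat \<Rightarrow> bool" where
  "upper_unipotent U \<longleftrightarrow> (\<forall>p. U $ p $ p = 1) \<and> (\<forall>p q. q < p \<longrightarrow> U $ p $ q = 0)"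

lemma unipotent_at_0_iff: "unipotent_at_0 u \<longleftrightarrow> upper_unipotent (fls_mat_coeff u 0)"
  by (simp add: unipotent_at_0_def upper_unipotent_def fls_mat_coeff_def)

text \<open>
  The Hessenberg shape survives because \<open>U\<close> moves entries only upwards and \<open>V B\<close> lives in the last
  column, all of whose positions are allowed.  The first column of \<open>U\<close> is the first unit vector, so
  \<open>U B = B\<close>.
\<close>

lemma hess_act_matrix:
  fixes x :: "'n::{finite,wellorder} \<times> 'n \<Rightarrow> real" and z :: real
  assumes "upper_unipotent U"
  defines "A \<equiv> (\<chi> p q. if (p, q) \<in> hess then x (p, q) else 0)"
    and "B \<equiv> ((\<chi> p q. if p = ix 1 \<and> q = ix (CARD('n)) then z else 0) :: 'n rmat)"
  shows "hess_point (hess_act U V (x, z)) = pcons (U ** A + V ** B) (pcons (U ** B) 0)"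
proof -
  have U: "U $ p $ p = 1" "q < p \<Longrightarrow> U $ p $ q = 0" for p q
    using assms(1) by (auto simp: upper_unipotent_def)
  have MB: "(M ** B) $ p $ q = (if q = ix (CARD('n)) then z * M $ p $ ix 1 else 0)" for M :: "'n rmat" and p q
    by (simp add: matrix_matrix_mult_def B_def if_distrib[of "\<lambda>t. _ * t"] cong: if_cong)
  have "U $ p $ ix 1 = (if p = ix 1 then 1 else 0)" for p
    using U ix_first_least[of p] by (auto simp: order_le_less)
  then have UB: "U ** B = B"
    unfolding vec_eq_iff MB by (auto simp: B_def)
  have UA: "(U ** A) $ p $ q =
      (if (p, q) \<in> hess then x (p, q) + (\<Sum>r | p < r \<and> (r, q) \<in> hess. U $ p $ r * x (r, q)) else 0)"
    for p q
  proof -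
    have "(U ** A) $ p $ q = (\<Sum>r\<in>UNIV. U $ p $ r * A $ r $ q)"
      by (simp add: matrix_matrix_mult_def)
    also have "\<dots> = (\<Sum>r\<in>UNIV. (if r = p then A $ p $ q else 0) +
        (if p < r \<and> (r, q) \<in> hess then U $ p $ r * x (r, q) else 0))"
      by (rule sum.cong) (auto simp: U A_def dest: order.strict_implies_not_eq not_less_iff_gr_or_eq[THEN iffD1])
    also have "\<dots> = A $ p $ q + (\<Sum>r | p < r \<and> (r, q) \<in> hess. U $ p $ r * x (r, q))"
      by (simp add: sum.distrib sum.If_cases)
    also have "\<dots> = (if (p, q) \<in> hess then x (p, q) + (\<Sum>r | p < r \<and> (r, q) \<in> hess. U $ p $ r * x (r, q)) else 0)"
      by (auto simp: A_def intro!: sum.neutral dest: hess_upward order.strict_implies_order)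
    finally show ?thesis .
  qed
  have "U ** A + V ** B = (\<chi> p q. if (p, q) \<in> hess then (\<lambda>i\<in>hess. x i + hess_shift U V z i x) (p, q) else 0)"
    by (auto simp: vec_eq_iff UA MB hess_shift_def hess_last_column)
  then show ?thesis
    by (simp add: hess_point_def hess_act_def UB) (simp add: B_def)
qed

lemma polar_proj_mult_hess_point:
  assumes "integral_mat u" "unipotent_at_0 u"
  shows "polar_proj (u ** polar_emb (hess_point w)) =
    hess_point (hess_act (fls_mat_coeff u 0) (fls_mat_coeff u 1) w)"
proof (cases w)
  case (Pair x z)
  then show ?thesis
    using assms hess_act_matrix[of "fls_mat_coeff u 0" "fls_mat_coeff u 1" x z]
    by (simp add: unipotent_at_0_iff hess_point_def polar_proj_mult_two_terms)
qed

text \<open>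
  The denominators do not move: in column \<open>k < n\<close> the entry at \<open>(k + 1, k)\<close> is the lowest one, and \<open>z\<close> is
  fixed.  The numerator at \<open>(k, k)\<close> gains \<open>U\<close> at \<open>(k, k + 1)\<close> times its denominator, and the one at
  \<open>(n, n)\<close> gains \<open>V\<close> at \<open>(n, 1)\<close> times \<open>z\<close>.  So every quotient is shifted by a constant.
\<close>

lemma psi_phase_hess_act:
  fixes x :: "'n::{finite,wellorder} \<times> 'n \<Rightarrow> real" and c :: "real^'n::{finite,wellorder}"
  assumes z: "z \<noteq> 0" and x: "\<And>k. k \<in> {1..<CARD('n)} \<Longrightarrow> x (ix (k + 1), ix k) \<noteq> 0"
  shows "psi_phase c (hess_act U V (x, z)) = psi_phase c (x, z) +
    ((\<Sum>k=1..CARD('n) - 1. c $ ix k * U $ ix k $ ix (k + 1)) + c $ ix (CARD('n)) * V $ ix (CARD('n)) $ ix 1)"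
proof -
  let ?y = "\<lambda>i\<in>hess. x i + hess_shift U V z i x"
  let ?n = "CARD('n)"
  have ratio: "?y (ix k, ix k) / ?y (ix (k + 1), ix k) = x (ix k, ix k) / x (ix (k + 1), ix k) + U $ ix k $ ix (k + 1)"
    if k: "k \<in> {1..?n - 1}" for k
  proof -
    have k': "k \<in> {1..?n}" "k + 1 \<in> {1..?n}" "k \<noteq> ?n" "?n \<in> {1..?n}"
      using k zero_less_card_finite[where 'a = 'n] unfolding atLeastAtMost_iff by linarith+
    have diag: "{r. ix k < r \<and> (r, ix k :: 'n) \<in> hess} = {ix (k + 1)}"
    proof (intro set_eqI)
      fix r :: 'n
      show "r \<in> {r. ix k < r \<and> (r, ix k :: 'n) \<in> hess} \<longleftrightarrow> r \<in> {ix (k + 1)}"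
        by (cases r rule: ix_cases) (use k' in \<open>auto simp: hess_ix_iff ix_less_iff ix_eq_iff\<close>)
    qed
    have subdiag: "{r. ix (k + 1) < r \<and> (r, ix k :: 'n) \<in> hess} = {}"
    proof (intro set_eqI)
      fix r :: 'n
      show "r \<in> {r. ix (k + 1) < r \<and> (r, ix k :: 'n) \<in> hess} \<longleftrightarrow> r \<in> {}"
        by (cases r rule: ix_cases) (use k' in \<open>auto simp: hess_ix_iff ix_less_iff ix_eq_iff\<close>)
    qed
    have ne: "(ix k :: 'n) \<noteq> ix ?n" using k' by (simp add: ix_eq_iff)
    have "hess_shift U V z (ix k, ix k) x = U $ ix k $ ix (k + 1) * x (ix (k + 1), ix k)"
      unfolding hess_shift_def case_prod_conv diag using ne by simp
    moreover have "hess_shift U V z (ix (k + 1), ix k) x = 0"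
      unfolding hess_shift_def case_prod_conv subdiag using ne by simp
    ultimately have "?y (ix k, ix k) = x (ix k, ix k) + U $ ix k $ ix (k + 1) * x (ix (k + 1), ix k)"
        "?y (ix (k + 1), ix k) = x (ix (k + 1), ix k)"
      using k' by (simp_all add: hess_ix_iff)
    then show ?thesis
      using x[of k] k by (auto simp: field_simps)
  qed
  have "{r. ix ?n < r \<and> (r, ix ?n :: 'n) \<in> hess} = {}"
    using ix_last_greatest by (auto simp: not_less[symmetric])
  then have "?y (ix ?n, ix ?n) = x (ix ?n, ix ?n) + z * V $ ix ?n $ ix 1"
    by (simp add: hess_last_column hess_shift_def)
  then have last: "?y (ix ?n, ix ?n) / z = x (ix ?n, ix ?n) / z + V $ ix ?n $ ix 1"
    using z by (simp add: field_simps)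
  have "(\<Sum>k=1..?n - 1. c $ ix k * (?y (ix k, ix k) / ?y (ix (k + 1), ix k))) =
      (\<Sum>k=1..?n - 1. c $ ix k * (x (ix k, ix k) / x (ix (k + 1), ix k)) + c $ ix k * U $ ix k $ ix (k + 1))"
    by (intro sum.cong refl) (simp only: ratio distrib_left)
  then show ?thesis
    by (simp only: psi_phase_def hess_act_def case_prod_conv last sum.distrib distrib_left add_ac)
qed

text \<open>
  For fixed \<open>z\<close> the map is triangular with respect to the row index, because \<open>hess_shift\<close> at \<open>(p, q)\<close>
  reads only entries in rows below \<open>p\<close>.  The coordinate \<open>z\<close> is then added by Fubini.
\<close>

lemma hess_act_preserves_hess_measure:
  fixes U V :: "'n::{finite,wellorder} rmat"
  shows "hess_act U V \<in> hess_measure \<rightarrow>\<^sub>M hess_measure"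
    and "distr hess_measure hess_measure (hess_act U V) = (hess_measure :: (('n \<times> 'n \<Rightarrow> real) \<times> real) measure)"
proof -
  let ?M = "PiM hess (\<lambda>_. lborel) :: ('n \<times> 'n \<Rightarrow> real) measure"
  let ?T = "\<lambda>z x. \<lambda>i\<in>hess. x i + hess_shift U V z i x"
  have act: "hess_act U V = (\<lambda>(x, z). (?T z x, z))"
    by (simp add: hess_act_def)
  have fin: "finite (hess :: ('n \<times> 'n) set)" by simp
  have comp: "(\<lambda>x. x i) \<in> borel_measurable ?M" if "i \<in> hess" for i
    using measurable_component_singleton[OF that, of "\<lambda>_. lborel :: real measure"] by simp
  have comp': "(\<lambda>w. fst w i) \<in> borel_measurable (?M \<Otimes>\<^sub>M lborel)" if "i \<in> hess" for i
    using measurable_compose[OF measurable_fst comp[OF that]] .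
  have joint: "(\<lambda>w. hess_shift U V (snd w) i (fst w)) \<in> borel_measurable (?M \<Otimes>\<^sub>M lborel)" for i
    unfolding hess_shift_def case_prod_beta
    by (cases "snd i = ix (CARD('n))"; simp only: if_True if_False;
        intro borel_measurable_add borel_measurable_sum borel_measurable_times comp') auto
  have T: "(\<lambda>(x, z). ?T z x) \<in> ?M \<Otimes>\<^sub>M lborel \<rightarrow>\<^sub>M ?M"
    unfolding case_prod_beta
    by (intro measurable_restrict) (use joint comp' in \<open>simp add: borel_measurable_add\<close>)
  show "hess_act U V \<in> hess_measure \<rightarrow>\<^sub>M (hess_measure :: (('n \<times> 'n \<Rightarrow> real) \<times> real) measure)"
    using measurable_Pair[OF T measurable_snd]
    by (simp add: act hess_measure_def case_prod_beta')
  show "distr hess_measure hess_measure (hess_act U V) = (hess_measure :: (('n \<times> 'n \<Rightarrow> real) \<times> real) measure)"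
    unfolding act hess_measure_def
  proof (rule distr_fibrewise_pair[OF _ _ T])
    fix z
    show "distr ?M ?M (?T z) = ?M"
    proof (rule distr_triangular_PiM_lborel[OF fin, where rk = fst])
      fix i :: "'n \<times> 'n"
      show "hess_shift U V z i \<in> borel_measurable ?M"
        unfolding hess_shift_def case_prod_beta
        by (intro borel_measurable_add borel_measurable_sum borel_measurable_times comp) auto
      fix x y :: "'n \<times> 'n \<Rightarrow> real"
      assume "\<And>j. fst i < fst j \<Longrightarrow> x j = y j"
      then show "hess_shift U V z i x = hess_shift U V z i y"
        by (auto simp: hess_shift_def case_prod_beta intro!: sum.cong)
    qed
  qed (auto intro: lborel_product.sigma_finite fin sigma_finite_lborel)
qed

section \<open>Absolute convergence\<close>

text \<open>
  All points \<open>hess_point w\<close> lie in the range of \<open>polar2\<close>.  This range is one finite-dimensional subspace,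
  on which the Schwartz condition is used, and it is parametrised by a Euclidean space, which
  makes measurability available.
\<close>

definition polar2 :: "'n rmat \<times> 'n rmat \<Rightarrow> ('n::finite) polar" where
  "polar2 = (\<lambda>(A, B). pcons A (pcons B 0))"

lemma lookup_scaleR_poly_mapping:
  "Poly_Mapping.lookup (a *\<^sub>R x) i = a *\<^sub>R Poly_Mapping.lookup x i"
  for x :: "'a \<Rightarrow>\<^sub>0 'b::real_vector"
proof -
  have "finite {i. a *\<^sub>R Poly_Mapping.lookup x i \<noteq> 0}"
    by (rule finite_subset[OF _ finite_keys[of x]]) (auto simp: in_keys_iff)
  then show ?thesis
    by (simp add: scaleR_poly_mapping_def lookup_Abs_poly_mapping)
qed

lemma norm_polar2: "norm (polar2 (A, B)) = norm A + norm B"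
proof -
  let ?x = "polar2 (A, B)"
  have "Poly_Mapping.keys ?x \<subseteq> {0, 1}"
    by (auto simp: in_keys_iff polar2_def lookup_pcons split: nat.splits)
  then have "norm ?x = (\<Sum>i\<in>{0, 1}. norm (Poly_Mapping.lookup ?x i))"
    unfolding norm_poly_mapping_def dist_poly_mapping_def
    by (intro sum.mono_neutral_cong_left) (auto simp: in_keys_iff)
  then show ?thesis by (simp add: polar2_def lookup_pcons)
qed

lemma bounded_linear_polar2: "bounded_linear (polar2 :: _ \<Rightarrow> ('n::finite) polar)"
proof (rule bounded_linear_intro[where K = 2])
  fix v w :: "'n rmat \<times> 'n rmat" and a :: real
  show "polar2 (v + w) = polar2 v + polar2 w"
    by (rule poly_mapping_eqI) (auto simp: polar2_def lookup_pcons lookup_add case_prod_beta split: nat.split)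
  show "polar2 (a *\<^sub>R v) = a *\<^sub>R polar2 v"
    by (rule poly_mapping_eqI)
      (auto simp: polar2_def lookup_pcons lookup_scaleR_poly_mapping case_prod_beta split: nat.split)
  show "norm (polar2 v) \<le> norm v * 2"
    using norm_fst_le[of "fst v" "snd v"] norm_snd_le[of "snd v" "fst v"] norm_polar2[of "fst v" "snd v"] by simp
qed

lemma schwartz_polar2:
  fixes f :: "('n::finite) polar \<Rightarrow> complex"
  assumes "f \<in> schwartz_space"
  shows "continuous_on UNIV (\<lambda>w. f (polar2 w))"
    and "\<exists>C. \<forall>w. norm (polar2 w) ^ k * norm (f (polar2 w)) \<le> C"
proof -
  let ?V = "range (polar2 :: _ \<Rightarrow> 'n polar)"
  have lin: "linear (polar2 :: _ \<Rightarrow> 'n polar)"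
    using bounded_linear_polar2 by (rule bounded_linear.linear)
  have "?V = span (polar2 ` Basis)"
    by (simp add: linear_span_image[OF lin] span_Basis)
  moreover have "finite (polar2 ` Basis :: 'n polar set)" by simp
  ultimately have "\<exists>B. finite B \<and> ?V = span B" by blast
  moreover have "subspace ?V"
    by (simp add: linear_subspace_image[OF lin])
  ultimately have "schwartz_on ?V f"
    using assms by (simp add: schwartz_space_def)
  then have *: "continuous_on ?V f \<and> (\<forall>k. \<exists>C. \<forall>x\<in>?V. norm x ^ k * norm (f x) \<le> C)"
    unfolding schwartz_on_def by (drule_tac x = "[]" in spec) (simp add: Let_def)
  then show "\<exists>C. \<forall>w. norm (polar2 w) ^ k * norm (f (polar2 w)) \<le> C" by auto
  show "continuous_on UNIV (\<lambda>w. f (polar2 w))"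
    using * linear_continuous_on[OF bounded_linear_polar2]
    by (metis continuous_on_compose2 subset_refl)
qed

lemma borel_measurable_vec_lambda:
  fixes g :: "'a \<Rightarrow> 'i::finite \<Rightarrow> 'b::euclidean_space"
  assumes "\<And>i. (\<lambda>w. g w i) \<in> borel_measurable M"
  shows "(\<lambda>w. \<chi> i. g w i) \<in> borel_measurable M"
  by (subst borel_measurable_euclidean_space)
    (use assms in \<open>auto simp: Basis_vec_def inner_axis borel_measurable_inner\<close>)

lemma measurable_hess_component:
  fixes i :: "'n::{finite,wellorder} \<times> 'n"
  assumes "i \<in> hess"
  shows "(\<lambda>w. fst w i) \<in> borel_measurable hess_measure"
  using measurable_compose[OF measurable_fst measurable_component_singleton[OF assms, of "\<lambda>_. lborel :: real measure"]]
  by (simp add: hess_measure_def)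

lemma hess_point_eq_polar2:
  "hess_point w = polar2 (\<chi> p q. if (p, q) \<in> hess then fst w (p, q) else 0,
     \<chi> p q. if p = ix 1 \<and> q = ix (CARD('n)) then snd w else 0)"
  for w :: "('n::{finite,wellorder} \<times> 'n \<Rightarrow> real) \<times> real"
  by (simp add: hess_point_def polar2_def case_prod_beta)

lemma measurable_schwartz_hess_point:
  fixes f :: "('n::{finite,wellorder}) polar \<Rightarrow> complex"
  assumes "f \<in> schwartz_space"
  shows "(\<lambda>w. f (hess_point w)) \<in> borel_measurable hess_measure"
proof -
  have "(\<lambda>w. (\<chi> p q. if (p, q) \<in> hess then fst w (p, q) else 0,
      \<chi> p q. if p = ix 1 \<and> q = ix (CARD('n)) then snd w else 0) :: 'n rmat \<times> 'n rmat)
    \<in> borel_measurable (hess_measure :: (('n \<times> 'n \<Rightarrow> real) \<times> real) measure)"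
  proof (intro borel_measurable_Pair borel_measurable_vec_lambda)
    fix p q :: 'n
    show "(\<lambda>w. if (p, q) \<in> hess then fst w (p, q) else 0) \<in> borel_measurable hess_measure"
      by (cases "(p, q) \<in> hess") (simp_all add: measurable_hess_component)
    show "(\<lambda>w. if p = ix 1 \<and> q = ix (CARD('n)) then snd w else 0)
        \<in> borel_measurable (hess_measure :: (('n \<times> 'n \<Rightarrow> real) \<times> real) measure)"
      by (cases "p = ix 1 \<and> q = ix (CARD('n))") (simp_all add: hess_measure_def)
  qed
  from measurable_compose[OF this borel_measurable_continuous_onI[OF schwartz_polar2(1)[OF assms]]]
  show ?thesis by (simp add: hess_point_eq_polar2)
qed

lemma measurable_psi_phase:
  fixes c :: "real^'n::{finite,wellorder}"
  shows "psi_phase c \<in> borel_measurable hess_measure"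
proof -
  have hess: "(ix k, ix k :: 'n) \<in> hess" "(ix (Suc k), ix k :: 'n) \<in> hess" if "k \<in> {1..CARD('n) - 1}" for k
    using that by (auto simp: hess_ix_iff)
  have "snd \<in> borel_measurable hess_measure" by (simp add: hess_measure_def)
  then show ?thesis
    unfolding psi_phase_def case_prod_beta
    by (intro borel_measurable_add borel_measurable_sum borel_measurable_times borel_measurable_divide
        measurable_hess_component) (auto simp: hess hess_last_column)
qed

lemma measurable_psi_integrand:
  assumes "f \<in> schwartz_space"
  shows "psi_integrand c f \<in> borel_measurable hess_measure"
  using measurable_schwartz_hess_point[OF assms] measurable_psi_phase[of c]
  unfolding psi_integrand_def by measurable

lemma prod_le_one_plus_power:
  fixes N :: real
  assumes "finite I" "\<And>i. i \<in> I \<Longrightarrow> \<bar>x i\<bar> \<le> N"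
  shows "(\<Prod>i\<in>I. 1 + (x i)\<^sup>2) \<le> (1 + N\<^sup>2) ^ card I"
proof -
  have "(x i)\<^sup>2 \<le> N\<^sup>2" if "i \<in> I" for i
    using assms(2)[OF that] by (metis abs_ge_zero power2_abs power_mono)
  then have "(\<Prod>i\<in>I. 1 + (x i)\<^sup>2) \<le> (\<Prod>i\<in>I. 1 + N\<^sup>2)"
    by (intro prod_mono) (auto intro: add_nonneg_nonneg)
  then show ?thesis by simp
qed

lemma one_plus_power_le:
  fixes N :: real
  shows "(1 + N\<^sup>2) ^ m \<le> 2 ^ m * (1 + N ^ (2 * m))"
proof -
  have "(1 + N\<^sup>2) ^ m \<le> (2 * max 1 (N\<^sup>2)) ^ m"
    by (intro power_mono) auto
  also have "\<dots> = 2 ^ m * max 1 (N\<^sup>2) ^ m"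
    by (simp add: power_mult_distrib)
  also have "max 1 (N\<^sup>2) ^ m \<le> 1 + N ^ (2 * m)"
    by (cases "1 \<le> N\<^sup>2") (simp_all add: max_def power_mult)
  finally show ?thesis by simp
qed

text \<open>
  Each coordinate of \<open>w\<close> is at most \<open>N = norm (hess_point w)\<close>, so the product of the \<open>m\<close> factors
  \<open>1 + t\<^sup>2\<close> is at most \<open>(1 + N\<^sup>2)\<^sup>m\<close>.  The Schwartz bounds with exponents \<open>0\<close> and \<open>2 m\<close> control this.
\<close>

lemma schwartz_hess_point_bound:
  fixes f :: "('n::{finite,wellorder}) polar \<Rightarrow> complex"
  assumes "f \<in> schwartz_space"
  obtains C where "\<And>x z. norm (f (hess_point (x, z))) \<le>
    C * ((\<Prod>i\<in>hess. 1 / (1 + (x i)\<^sup>2)) * (1 / (1 + z\<^sup>2)))"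
proof -
  define m where "m = card (hess :: ('n \<times> 'n) set) + 1"
  obtain C0 where C0: "norm (f (polar2 w)) \<le> C0" for w
    using schwartz_polar2(2)[OF assms, of 0] by auto
  obtain C1 where C1: "norm (polar2 w) ^ (2 * m) * norm (f (polar2 w)) \<le> C1" for w
    using schwartz_polar2(2)[OF assms, of "2 * m"] by auto
  show thesis
  proof
    fix x :: "'n \<times> 'n \<Rightarrow> real" and z :: real
    define A :: "'n rmat" where "A = (\<chi> p q. if (p, q) \<in> hess then x (p, q) else 0)"
    define B :: "'n rmat" where "B = (\<chi> p q. if p = ix 1 \<and> q = ix (CARD('n)) then z else 0)"
    have pt: "hess_point (x, z) = polar2 (A, B)"
      by (simp add: hess_point_eq_polar2 A_def B_def cong: if_cong)
    define N where "N = norm (polar2 (A, B))"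
    let ?F = "norm (f (polar2 (A, B)))"
    let ?P = "(\<Prod>i\<in>hess. 1 + (x i)\<^sup>2) * (1 + z\<^sup>2)"
    have entry: "\<bar>M $ p $ q\<bar> \<le> norm M" for M :: "'n rmat" and p q
      using component_le_norm_cart[of "M $ p" q] Finite_Cartesian_Product.norm_nth_le[of M p] by linarith
    have x: "\<bar>x i\<bar> \<le> N" if "i \<in> hess" for i
      using that entry[of A "fst i" "snd i"]
      by (simp add: N_def norm_polar2 A_def add_increasing2)
    have z: "\<bar>z\<bar> \<le> N"
      using entry[of B "ix 1" "ix (CARD('n))"] by (simp add: N_def norm_polar2 B_def add_increasing)
    have "?P \<le> (1 + N\<^sup>2) ^ card (hess :: ('n \<times> 'n) set) * (1 + N\<^sup>2)"
      using prod_le_one_plus_power[of hess x N] prod_le_one_plus_power[of "{()}" "\<lambda>_. z" N] x z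
      by (intro mult_mono) (auto intro!: prod_nonneg)
    also have "\<dots> \<le> 2 ^ m * (1 + N ^ (2 * m))"
      using one_plus_power_le[of N m] by (simp add: m_def mult.commute)
    finally have "?F * ?P \<le> ?F * (2 ^ m * (1 + N ^ (2 * m)))"
      by (intro mult_left_mono) auto
    also have "\<dots> = 2 ^ m * (?F + N ^ (2 * m) * ?F)" by (simp add: algebra_simps)
    also have "\<dots> \<le> 2 ^ m * (C0 + C1)"
      using C0[of "(A, B)"] C1[of "(A, B)"] by (intro mult_left_mono add_mono) (auto simp: N_def)
    finally have "?F * ?P \<le> 2 ^ m * (C0 + C1)" .
    moreover have "?P > 0"
      by (intro mult_pos_pos prod_pos) (auto intro: add_pos_nonneg)
    ultimately have "?F \<le> 2 ^ m * (C0 + C1) / ?P"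
      by (simp add: pos_le_divide_eq)
    then show "norm (f (hess_point (x, z))) \<le>
        2 ^ m * (C0 + C1) * ((\<Prod>i\<in>hess. 1 / (1 + (x i)\<^sup>2)) * (1 / (1 + z\<^sup>2)))"
      by (simp add: pt prod_dividef)
  qed
qed

lemma integrable_hess_weight:
  "integrable hess_measure (\<lambda>(x, z). (\<Prod>i\<in>hess. 1 / (1 + (x i)\<^sup>2)) * (1 / (1 + z\<^sup>2)))"
  (is "integrable _ ?g")
proof -
  let ?h = "\<lambda>t::real. 1 / (1 + t\<^sup>2)"
  let ?I = "hess :: ('a \<times> 'a) set"
  have fin: "finite ?I" by simp
  have meas: "(\<lambda>x. \<Prod>i\<in>?I. ennreal (?h (x i))) \<in> borel_measurable (PiM ?I (\<lambda>_. lborel))"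
    by measurable
  have meas2: "(\<lambda>w. (\<Prod>i\<in>?I. ennreal (?h (fst w i))) * ennreal (?h (snd w)))
      \<in> borel_measurable (PiM ?I (\<lambda>_. lborel) \<Otimes>\<^sub>M lborel)"
    by measurable
  have eq: "ennreal (norm (?g w)) = (\<Prod>i\<in>?I. ennreal (?h (fst w i))) * ennreal (?h (snd w))" for w
    by (simp add: case_prod_beta abs_mult abs_prod ennreal_mult prod_nonneg prod_ennreal del: times_divide_eq_right)
  have "(\<integral>\<^sup>+ w. ennreal (norm (?g w)) \<partial>hess_measure)
      = (\<integral>\<^sup>+ x. \<integral>\<^sup>+ z. (\<Prod>i\<in>?I. ennreal (?h (x i))) * ennreal (?h z) \<partial>lborel \<partial>PiM ?I (\<lambda>_. lborel))"
    using lborel.nn_integral_fst[OF meas2] by (simp only: eq hess_measure_def fst_conv snd_conv)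
  also have "\<dots> = (\<integral>\<^sup>+ x. (\<Prod>i\<in>?I. ennreal (?h (x i))) \<partial>PiM ?I (\<lambda>_. lborel)) * (\<integral>\<^sup>+ z. ennreal (?h z) \<partial>lborel)"
    using meas by (simp add: nn_integral_cmult nn_integral_multc)
  also have "(\<integral>\<^sup>+ x. (\<Prod>i\<in>?I. ennreal (?h (x i))) \<partial>PiM ?I (\<lambda>_. lborel)) = (\<Prod>i\<in>?I. \<integral>\<^sup>+ z. ennreal (?h z) \<partial>lborel)"
    by (rule lborel_product.product_nn_integral_prod[OF fin]) simp
  also have "\<dots> * (\<integral>\<^sup>+ z. ennreal (?h z) \<partial>lborel) < \<infinity>"
    using nn_integral_inverse_1_plus_square_finite
    by (simp add: ennreal_mult_less_top power_less_top_ennreal)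
  finally have "(\<integral>\<^sup>+ w. ennreal (norm (?g w)) \<partial>hess_measure) < \<infinity>" .
  moreover have "?g \<in> borel_measurable hess_measure"
    unfolding hess_measure_def case_prod_beta by measurable
  ultimately show ?thesis by (simp add: integrable_iff_bounded)
qed

lemma integrable_psi_integrand:
  fixes f :: "('n::{finite,wellorder}) polar \<Rightarrow> complex"
  assumes "f \<in> schwartz_space"
  shows "integrable hess_measure (psi_integrand c f)"
proof -
  obtain C where C: "norm (f (hess_point (x, z))) \<le>
      C * ((\<Prod>i\<in>hess. 1 / (1 + (x i)\<^sup>2)) * (1 / (1 + z\<^sup>2)))" for x z
    using schwartz_hess_point_bound[OF assms] by blast
  show ?thesis
  proof (rule Bochner_Integration.integrable_bound)
    show "integrable hess_measure (\<lambda>w. C * (case w of (x, z) \<Rightarrow> (\<Prod>i\<in>hess. 1 / (1 + (x i)\<^sup>2)) * (1 / (1 + z\<^sup>2))))"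
      by (intro integrable_mult_right integrable_hess_weight)
    show "psi_integrand c f \<in> borel_measurable hess_measure"
      using assms by (rule measurable_psi_integrand)
    have "norm (psi_integrand c f w) = norm (f (hess_point w))" for w
      by (simp add: psi_integrand_def norm_mult norm_exp_eq_Re)
    then show "AE w in hess_measure. norm (psi_integrand c f w)
        \<le> norm (C * (case w of (x, z) \<Rightarrow> (\<Prod>i\<in>hess. 1 / (1 + (x i)\<^sup>2)) * (1 / (1 + z\<^sup>2))))"
      using order_trans[OF C abs_ge_self] by (intro AE_I2) (simp only: split_paired_all case_prod_conv real_norm_def)
  qed
qed

section \<open>The Whittaker property\<close>

lemma AE_hess_measure_neq_0:
  fixes i :: "'n::{finite,wellorder} \<times> 'n"
  shows "i \<in> hess \<Longrightarrow> AE w in hess_measure. fst w i \<noteq> 0"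
    and "AE w in (hess_measure :: (('n \<times> 'n \<Rightarrow> real) \<times> real) measure). snd w \<noteq> 0"
proof -
  interpret pair_sigma_finite "PiM hess (\<lambda>_. lborel) :: ('n \<times> 'n \<Rightarrow> real) measure" "lborel :: real measure"
    by (simp add: pair_sigma_finite_def lborel_product.sigma_finite sigma_finite_lborel)
  show "AE w in hess_measure. fst w i \<noteq> 0" if i: "i \<in> hess"
    unfolding hess_measure_def
  proof (rule AE_pair_measure)
    have "(\<lambda>w. fst w i) \<in> borel_measurable (PiM hess (\<lambda>_. lborel :: real measure) \<Otimes>\<^sub>M (lborel :: real measure))"
      using measurable_hess_component[OF i] by (simp add: hess_measure_def)
    then show "{w \<in> space (PiM hess (\<lambda>_. lborel :: real measure) \<Otimes>\<^sub>M (lborel :: real measure)). fst w i \<noteq> 0}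
        \<in> sets (PiM hess (\<lambda>_. lborel :: real measure) \<Otimes>\<^sub>M (lborel :: real measure))"
      by measurable
    show "AE x in PiM hess (\<lambda>_. lborel :: real measure). AE z in (lborel :: real measure). fst (x, z) i \<noteq> 0"
      using AE_PiM_lborel_neq[OF finite i, of 0] by (rule eventually_mono) simp
  qed
  show "AE w in (hess_measure :: (('n \<times> 'n \<Rightarrow> real) \<times> real) measure). snd w \<noteq> 0"
    unfolding hess_measure_def
  proof (rule AE_pair_measure)
    show "{w \<in> space (PiM hess (\<lambda>_. lborel :: real measure) \<Otimes>\<^sub>M (lborel :: real measure)). snd w \<noteq> 0}
        \<in> sets (PiM hess (\<lambda>_. lborel :: real measure) \<Otimes>\<^sub>M (lborel :: real measure))"
      by measurable
    show "AE x in PiM hess (\<lambda>_. lborel :: real measure). AE z in (lborel :: real measure). snd (x, z) \<noteq> 0"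
      by (simp add: AE_lborel_singleton)
  qed
qed

lemma psi_hess_act:
  fixes c :: "real^'n::{finite,wellorder}"
  assumes f: "f \<in> schwartz_space"
  shows "psi c f = (LINT w|hess_measure. f (hess_point (hess_act U V w)) *
      exp (2 * complex_of_real pi * \<i> * complex_of_real (psi_phase c (hess_act U V w))))"
proof -
  have "psi c f = (LINT w|distr hess_measure hess_measure (hess_act U V). psi_integrand c f w)"
    by (simp add: psi_def hess_act_preserves_hess_measure)
  also have "\<dots> = (LINT w|hess_measure. psi_integrand c f (hess_act U V w))"
    by (intro integral_distr hess_act_preserves_hess_measure measurable_psi_integrand f)
  finally show ?thesis by (simp add: psi_integrand_def)
qed

text \<open>
  After the translation by \<open>u\<close> the argument of \<open>f\<close> is \<open>hess_point (hess_act U V w)\<close>.  Off the null set of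
  vanishing denominators, the phase at \<open>w\<close> is the phase at \<open>hess_act U V w\<close> minus a constant, and the
  constant leaves the integral as the character.  The remaining integrand is a function of
  \<open>hess_act U V w\<close>, and \<open>hess_act U V\<close> preserves the measure.
\<close>

lemma pi1_dual_psi:
  fixes c :: "real^'n::{finite,wellorder}"
  assumes u: "u \<in> SL_power_series" "unipotent_at_0 u" and f: "f \<in> schwartz_space"
  shows "pi1_dual u (psi c) f = chi_hat c u * psi c f"
proof -
  define U where "U = fls_mat_coeff u 0"
  define V where "V = fls_mat_coeff u 1"
  define s where "s = (\<Sum>k=1..CARD('n) - 1. c $ ix k * U $ ix k $ ix (k + 1))
      + c $ ix (CARD('n)) * V $ ix (CARD('n)) $ ix 1"
  let ?e = "\<lambda>t. exp (2 * complex_of_real pi * \<i> * complex_of_real t)"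
  have chi: "chi_hat c u = ?e (- s)"
    by (simp only: chi_hat_def s_def U_def V_def fls_mat_coeff_def vec_lambda_beta of_real_minus mult_minus_right)
  have hp: "polar_proj (u ** polar_emb (hess_point w)) = hess_point (hess_act U V w)" for w
    using u by (simp add: U_def V_def polar_proj_mult_hess_point SL_power_series_iff)
  have phase: "AE w in hess_measure. psi_phase c (hess_act U V w) = psi_phase c w + s"
  proof -
    have "AE w in (hess_measure :: (('n \<times> 'n \<Rightarrow> real) \<times> real) measure). \<forall>k\<in>{1..<CARD('n)}. fst w (ix (k + 1), ix k) \<noteq> 0"
      by (intro AE_finite_allI AE_hess_measure_neq_0) (auto simp: hess_ix_iff)
    moreover have "AE w in (hess_measure :: (('n \<times> 'n \<Rightarrow> real) \<times> real) measure). snd w \<noteq> 0"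
      by (rule AE_hess_measure_neq_0)
    ultimately show ?thesis
    proof eventually_elim
      case (elim w)
      then show ?case
        using psi_phase_hess_act[of "snd w" "fst w" c U V] by (simp add: s_def)
    qed
  qed
  have act: "hess_act U V \<in> hess_measure \<rightarrow>\<^sub>M hess_measure"
    by (rule hess_act_preserves_hess_measure)
  note [measurable] = measurable_compose[OF act measurable_schwartz_hess_point[OF f]]
    measurable_psi_phase[of c] measurable_compose[OF act measurable_psi_phase[of c]]
  have "pi1_dual u (psi c) f = (LINT w|hess_measure. f (hess_point (hess_act U V w)) * ?e (psi_phase c w))"
    by (simp add: pi1_dual_eq u(1) psi_def psi_integrand_def hp)
  also have "\<dots> = (LINT w|hess_measure. ?e (- s) *
      (f (hess_point (hess_act U V w)) * ?e (psi_phase c (hess_act U V w))))"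
  proof (rule integral_cong_AE)
    show "AE w in hess_measure. f (hess_point (hess_act U V w)) * ?e (psi_phase c w) =
        ?e (- s) * (f (hess_point (hess_act U V w)) * ?e (psi_phase c (hess_act U V w)))"
      using phase
    proof eventually_elim
      case (elim w)
      have "?e (psi_phase c w) = ?e (- s) * ?e (psi_phase c (hess_act U V w))"
        unfolding elim by (simp add: algebra_simps flip: exp_add)
      then show ?case by simp
    qed
  qed measurable
  also have "\<dots> = ?e (- s) * psi c f"
    by (simp only: integral_mult_right_zero psi_hess_act[OF f, of c U V])
  finally show ?thesis by (simp only: chi)
qed

lemma linear_functional_psi:
  assumes "S \<subseteq> schwartz_space"
  shows "linear_functional_on S (psi c)"
  unfolding linear_functional_on_def
proof (intro ballI allI)
  fix f g and a b :: complex
  assume "f \<in> S" "g \<in> S"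
  then have int: "integrable hess_measure (psi_integrand c f)" "integrable hess_measure (psi_integrand c g)"
    using assms by (auto intro: integrable_psi_integrand)
  have "psi_integrand c (\<lambda>x. a * f x + b * g x) =
      (\<lambda>w. a * psi_integrand c f w + b * psi_integrand c g w)"
    by (simp add: psi_integrand_def fun_eq_iff algebra_simps)
  then show "psi c (\<lambda>x. a * f x + b * g x) = a * psi c f + b * psi c g"
    using int by (simp add: psi_def)
qed

theorem mainTheorem11:
  fixes lam :: complex and c :: "real^'n::{finite,wellorder}"
  assumes "CARD('n) \<ge> 2" and "lam \<noteq> 0"
  shows "(\<forall>f\<in>schwartz_eig lam. integrable hess_measure (psi_integrand c f))
    \<and> linear_functional_on (schwartz_eig lam) (psi c)
    \<and> (\<forall>u\<in>SL_power_series. unipotent_at_0 u \<longrightarrow>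
         (\<forall>f\<in>schwartz_eig lam. pi1_dual u (psi c) f = chi_hat c u * psi c f))"
proof -
  have sub: "schwartz_eig lam \<subseteq> (schwartz_space :: ('n polar \<Rightarrow> complex) set)"
    by (auto simp: schwartz_eig_def)
  then show ?thesis
    by (auto simp: integrable_psi_integrand linear_functional_psi pi1_dual_psi)
qed

end
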